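(* The exponents in the weighted change of angle estimates for $\mathcal{A}^\alpha$ cannot be improved, in the following sense. (i) Let $1\le r<\infty$ and $0<p\le 2r$. There is no $0<\varrho<\frac{nr}{p}$ such that for every $w\in A_r$ there exists a constant $C_w$ for which $$\|\mathcal{A}^{\alpha}F\|_{L^p(w)}\le C_w\,\alpha^{\frac{nr}{p}-\varrho}\,\|\mathcal{A}^1F\|_{L^p(w)}$$ holds for all $\alpha\ge1$ and all measurable functions $F$ on $\mathbb{R}^{n+1}_+$. (ii) Let $1\le s<\infty$ and $\frac2s\le p<\infty$. There is no $\varrho>0$ such that for every $w\in RH_{s'}$ there exists a constant $C_w$ for which $$\|\mathcal{A}^1F\|_{L^p(w)}\le C_w\,\alpha^{-\frac{n}{sp}-\varrho}\,\|\mathcal{A}^{\alpha}F\|_{L^p(w)}$$ holds for all $\alpha\ge1$ and all measurable functions $F$ on $\mathbb{R}^{n+1}_+$.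
   Context: $\mathbb{R}^{n+1}_+=\{(y,t):y\in\mathbb{R}^n,\ t>0\}$. For $\alpha>0$ and $x\in\mathbb{R}^n$, $\Gamma^\alpha(x)=\{(y,t)\in\mathbb{R}^{n+1}_+:|x-y|<\alpha t\}$ and $$\mathcal{A}^\alpha F(x)=\Big(\iint_{\Gamma^\alpha(x)}|F(y,t)|^2\frac{dy\,dt}{t^{n+1}}\Big)^{1/2}.$$ A weight is a positive locally integrable function on $\mathbb{R}^n$; $A_r$ ($1\le r<\infty$) are the usual Muckenhoupt classes and $RH_{q}$ ($1<q\le\infty$) the usual reverse Hölder classes, defined with balls. $s'=s/(s-1)$ is the conjugate exponent ($s'=\infty$ if $s=1$). $\|g\|_{L^p(w)}=(\int_{\mathbb{R}^n}|g|^pw\,dx)^{1/p}$. The change of angle estimates referred to are $\|\mathcal{A}^{\beta}F\|_{L^p(w)}\le C(\beta/\alpha)^{nr/p}\|\mathcal{A}^{\alpha}F\|_{L^p(w)}$ for $w\in A_r$, $0<p\le 2r$, and $\|\mathcal{A}^{\alpha}F\|_{L^p(w)}\le C(\alpha/\beta)^{n/(sp)}\|\mathcal{A}^{\beta}F\|_{L^p(w)}$ for $w\in RH_{s'}$, $2/s\le p<\infty$, where $0<\alpha\le\beta<\infty$. *)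

theory Defs
  imports "HOL-Analysis.Analysis"
begin

(* Powers with positive exponent a; top is sent to top. *)
definition enn_powr :: "ennreal \<Rightarrow> real \<Rightarrow> ennreal" (infixr "epowr" 80) where
  "x epowr a = (if x = \<infinity> then \<infinity> else ennreal (enn2real x powr a))"

definition upper_half :: "((real^'n) \<times> real) set" where
  "upper_half = {(y, t). 0 < t}"

definition cone :: "real \<Rightarrow> real^'n \<Rightarrow> ((real^'n) \<times> real) set" where
  "cone \<alpha> x = {(y, t) \<in> upper_half. norm (x - y) < \<alpha> * t}"

definition area_fun :: "real \<Rightarrow> ((real^'n) \<times> real \<Rightarrow> complex) \<Rightarrow> real^'n \<Rightarrow> ennreal" where
  "area_fun \<alpha> F x =
     (\<integral>\<^sup>+(y, t)\<in>cone \<alpha> x. ennreal ((norm (F (y, t)))\<^sup>2 / t ^ (CARD('n) + 1)) \<partial>lebesgue) epowr (1/2)"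

definition weight :: "(real^'n \<Rightarrow> real) \<Rightarrow> bool" where
  "weight w \<longleftrightarrow> (\<forall>x. 0 < w x) \<and> (\<forall>K. compact K \<longrightarrow> set_integrable lebesgue K w)"

definition ball_avg :: "real^'n \<Rightarrow> real \<Rightarrow> (real^'n \<Rightarrow> real) \<Rightarrow> ennreal" where
  "ball_avg x \<rho> f =
     (\<integral>\<^sup>+y\<in>ball x \<rho>. ennreal (f y) \<partial>lebesgue) / emeasure lebesgue (ball x \<rho>)"

(* Used for 1 \<le> r only. *)
definition muckenhoupt :: "real \<Rightarrow> (real^'n \<Rightarrow> real) set" where
  "muckenhoupt r = {w. weight w \<and>
     (if r = 1
      then \<exists>C::real. \<forall>x \<rho>. 0 < \<rho> \<longrightarrow>
             (AE y in lebesgue. y \<in> ball x \<rho> \<longrightarrow> ball_avg x \<rho> w \<le> ennreal (C * w y))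
      else \<exists>C::real. \<forall>x \<rho>. 0 < \<rho> \<longrightarrow>
             ball_avg x \<rho> w * ball_avg x \<rho> (\<lambda>y. w y powr (1 - r / (r - 1))) epowr (r - 1)
               \<le> ennreal C)}"

(* Used for 1 < q \<le> \<infinity> only. *)
definition reverse_hoelder :: "ennreal \<Rightarrow> (real^'n \<Rightarrow> real) set" where
  "reverse_hoelder q = {w. weight w \<and>
     (if q = \<infinity>
      then \<exists>C::real. \<forall>x \<rho>. 0 < \<rho> \<longrightarrow>
             (AE y in lebesgue. y \<in> ball x \<rho> \<longrightarrow> ennreal (w y) \<le> ennreal C * ball_avg x \<rho> w)
      else \<exists>C::real. \<forall>x \<rho>. 0 < \<rho> \<longrightarrow>
             ball_avg x \<rho> (\<lambda>y. w y powr enn2real q) epowr (1 / enn2real q)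
               \<le> ennreal C * ball_avg x \<rho> w)}"

definition conj_exp :: "real \<Rightarrow> ennreal" where
  "conj_exp s = (if s = 1 then \<infinity> else ennreal (s / (s - 1)))"

definition weighted_Lp :: "real \<Rightarrow> (real^'n \<Rightarrow> real) \<Rightarrow> (real^'n \<Rightarrow> ennreal) \<Rightarrow> ennreal" where
  "weighted_Lp p w g = (\<integral>\<^sup>+x. g x epowr p * ennreal (w x) \<partial>lebesgue) epowr (1/p)"

end

theory Submission
  imports Defs
begin

text \<open>
  Test with power weights $w_a(x) = |x|^a$, $a > -n$, and with the indicator $F$ of a ball of
  radius $1/2$ at height $3/2$. For $\alpha \ge 1$ the function $A^\alpha F$ is comparable to $1$
  on $B(0,\alpha/2)$, bounded, and supported in $B(0,3\alpha)$, so
  $\|A^\alpha F\|_{L^p(w_a)}$ grows like $w_a(B(0,\alpha))^{1/p}$, that is, like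
  $\alpha^{(n+a)/p}$. For (i), $w_a \in A_r$ for $0 \le a < n(r-1)$, and $a \to n(r-1)$ gives
  the exponent $nr/p$; for (ii), $w_a \in RH_{s'}$ for $-n/s' < a \le 0$, and $a \to -n/s'$
  gives $n/(sp)$. At the endpoints $r = 1$ and $s = 1$ the constant weight suffices.
\<close>

\<comment> \<open>The value 1 at the origin keeps the weight strictly positive, since \<open>0 powr a = 0\<close>.\<close>
definition power_weight :: "real \<Rightarrow> real^'n \<Rightarrow> real" where
  "power_weight a x = (if x = 0 then 1 else norm x powr a)"

section \<open>Elementary facts on power weights, balls and dyadic scales\<close>

lemma power_weight_pos: "0 < power_weight a x"
  by (simp add: power_weight_def)

lemma power_weight_powr: "power_weight a x powr c = power_weight (a * c) x"
  by (simp add: power_weight_def powr_powr)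

lemma borel_measurable_power_weight [measurable]: "power_weight a \<in> borel_measurable borel"
  unfolding power_weight_def by measurable

lemma borel_measurable_power_weight_lebesgue [measurable]:
  "power_weight a \<in> borel_measurable lebesgue"
  by (intro measurable_completion) simp

lemma AE_lebesgue_neq: "AE x in (lebesgue :: 'a::euclidean_space measure). x \<noteq> c"
  by (intro AE_completion AE_lborel_singleton)

lemma sets_lebesgue_ball [measurable]: "ball x r \<in> sets lebesgue"
  by simp

lemma emeasure_lebesgue_ball_neq:
  fixes x :: "'a::euclidean_space"
  assumes "0 < r"
  shows "emeasure lebesgue (ball x r) \<noteq> 0" "emeasure lebesgue (ball x r) \<noteq> \<infinity>"
  using assms unit_ball_vol_pos[of "real (DIM('a))"] by (simp_all add: emeasure_ball not_le del: unit_ball_vol_pos)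

lemma le_suminf_ennreal: "f k \<le> (\<Sum>k. f k :: ennreal)"
  using sum_le_suminf[OF summableI, of "{k}" f] by simp

text \<open>Used to place a nonzero point of a ball in one of its dyadic shells. The index comes
  from the least k with R / 2^k <= t, which exists because R / 2^k tends to 0.\<close>

lemma dyadic_scale_exists:
  fixes R t :: real
  assumes "0 < t" "t < R"
  obtains k :: nat where "R / 2 ^ Suc k \<le> t" "t < R / 2 ^ k"
proof -
  obtain m :: nat where m: "R / t < 2 ^ m"
    using real_arch_pow[of 2 "R / t"] by auto
  then have m': "R / 2 ^ m \<le> t"
    using assms by (simp add: field_simps)
  define k where "k = (LEAST k. R / 2 ^ k \<le> t)"
  have k: "R / 2 ^ k \<le> t"
    unfolding k_def using m' by (rule LeastI)
  \<comment> \<open>The least index is not 0, since R / 2^0 = R > t. Its predecessor j violates the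
    inequality, and this is the strict upper bound.\<close>
  with assms obtain j where j: "k = Suc j"
    by (cases k) auto
  then have "\<not> R / 2 ^ j \<le> t"
    using not_less_Least[of j "\<lambda>k. R / 2 ^ k \<le> t"] unfolding k_def by simp
  with k j that show ?thesis by force
qed

section \<open>Integrals and averages of power weights over balls\<close>

text \<open>Cut the punctured ball into the shells R / 2^(k+1) <= |y| < R / 2^k. Since a <= 0, the
  weight on a shell is at most its value at the inner radius, and the shell has at most the volume
  of B(0, R / 2^k). These bounds form a geometric series, convergent because a > -n.\<close>

lemma nn_integral_power_weight_ball_le:
  assumes a: "- real CARD('n) < a" "a \<le> 0"
  obtains K where "0 < K"
    "\<And>R. 0 < R \<Longrightarrow> (\<integral>\<^sup>+y\<in>ball 0 R. ennreal (power_weight a (y::real^'n)) \<partial>lebesgue)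
              \<le> ennreal (K * R powr (real CARD('n) + a))"
proof
  define n where "n = CARD('n)"
  \<comment> \<open>Ratio of the bounds for consecutive shells; it is below 1 exactly when n + a >
    0.\<close>
  define q where "q = (2::real) powr - (real n + a)"
  have q: "0 < q" "q < 1"
    using a powr_less_mono[of "- (real n + a)" 0 2] by (simp_all add: q_def n_def)
  define V where "V = unit_ball_vol (real n)"
  have V: "0 < V" by (simp add: V_def)
  \<comment> \<open>The factor \<open>2 powr - a\<close> comes from evaluating the weight at half of
    the outer radius, and 1 / (1 - q) is the sum of the geometric series.\<close>
  define K where "K = V * 2 powr - a / (1 - q)"
  show "0 < K" using V q by (simp add: K_def)
  fix R :: real assume R: "0 < R"
  \<comment> \<open>Each summand lives on the whole ball instead of the shell: the term of the right
    index already dominates the weight at y, and the volume is explicit.\<close>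
  let ?f = "\<lambda>k (y::real^'n). ennreal ((R / 2 ^ Suc k) powr a) * indicator (ball 0 (R / 2 ^ k)) y"
  have "(\<integral>\<^sup>+y\<in>ball 0 R. ennreal (power_weight a (y::real^'n)) \<partial>lebesgue)
      \<le> (\<integral>\<^sup>+y. (\<Sum>k. ?f k y) \<partial>lebesgue)"
  proof (intro nn_integral_mono_AE eventually_mono[OF AE_lebesgue_neq[of 0]])
    fix y :: "real^'n" assume y: "y \<noteq> 0"
    show "ennreal (power_weight a y) * indicator (ball 0 R) y \<le> (\<Sum>k. ?f k y)"
    proof (cases "norm y < R")
      case True
      with y obtain k where k: "R / 2 ^ Suc k \<le> norm y" "norm y < R / 2 ^ k"
        using dyadic_scale_exists[of "norm y" R] by auto
      have "ennreal (power_weight a y) * indicator (ball 0 R) y \<le> ?f k y"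
        using k R y a powr_mono2'[of a "R / 2 ^ Suc k" "norm y"] True
        by (simp add: power_weight_def ennreal_leI del: power_Suc)
      also have "\<dots> \<le> (\<Sum>k. ?f k y)"
        by (rule le_suminf_ennreal)
      finally show ?thesis .
    qed simp
  qed
  also have "\<dots> = (\<Sum>k. \<integral>\<^sup>+y. ?f k y \<partial>lebesgue)"
    by (intro nn_integral_suminf) measurable
  also have "\<dots> = (\<Sum>k. ennreal (V * 2 powr - a * R powr (real n + a) * q ^ k))"
  proof (intro suminf_cong)
    fix k
    have pk: "(2::real) ^ k = 2 powr real k" by (simp add: powr_realpow)
    have eq: "(R / 2 ^ Suc k) powr a * (V * (R / 2 ^ k) ^ n) = V * 2 powr - a * R powr (real n + a) * q ^ k"
    proof -
      have "(R / 2 ^ Suc k) powr a = R powr a * 2 powr - a * 2 powr (- real k * a)"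
        using R by (simp add: powr_divide powr_mult powr_minus_divide pk powr_powr)
      moreover have "(R / 2 ^ k) ^ n = R powr real n * 2 powr (- real k * real n)"
        using R by (simp add: powr_realpow[symmetric] powr_divide powr_powr powr_minus_divide)
      moreover have "q ^ k = 2 powr (- real k * real n) * 2 powr (- real k * a)"
        unfolding q_def by (simp add: powr_realpow[symmetric] powr_powr powr_add[symmetric] algebra_simps)
      ultimately show ?thesis by (simp add: powr_add)
    qed
    show "(\<integral>\<^sup>+y. ?f k y \<partial>lebesgue) = ennreal (V * 2 powr - a * R powr (real n + a) * q ^ k)"
      unfolding eq[symmetric] using R V
      by (subst nn_integral_cmult_indicator)
         (auto simp: emeasure_ball ennreal_mult[symmetric] V_def n_def simp del: power_Suc mult_eq_0_iff)
  qed
  also have "\<dots> = ennreal (V * 2 powr - a * R powr (real n + a) * (1 / (1 - q)))"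
    using q V by (intro suminf_ennreal_eq sums_mult geometric_sums) auto
  also have "\<dots> = ennreal (K * R powr (real CARD('n) + a))"
    by (simp add: K_def n_def field_simps)
  finally show "(\<integral>\<^sup>+y\<in>ball 0 R. ennreal (power_weight a (y::real^'n)) \<partial>lebesgue)
              \<le> ennreal (K * R powr (real CARD('n) + a))" .
qed

text \<open>The bound is asked for almost everywhere so that the origin, where the power weight has
  the artificial value 1, can be discarded.\<close>

lemma ball_avg_le:
  fixes x :: "real^'n"
  assumes "AE y in lebesgue. y \<in> ball x \<rho> \<longrightarrow> f y \<le> c" "0 < \<rho>"
  shows "ball_avg x \<rho> f \<le> ennreal c"
proof -
  let ?B = "emeasure lebesgue (ball x \<rho>)"
  have "(\<integral>\<^sup>+y\<in>ball x \<rho>. ennreal (f y) \<partial>lebesgue) \<le> (\<integral>\<^sup>+y\<in>ball x \<rho>. ennreal c \<partial>lebesgue)"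
    using assms(1) by (intro nn_integral_mono_AE) (auto elim!: eventually_mono split: split_indicator intro: ennreal_leI)
  also have "\<dots> = ennreal c * ?B"
    by (simp add: nn_integral_cmult_indicator)
  finally have "ball_avg x \<rho> f \<le> ennreal c * ?B / ?B"
    unfolding ball_avg_def by (rule divide_right_mono_ennreal)
  also have "\<dots> = ennreal c"
    using emeasure_lebesgue_ball_neq[OF \<open>0 < \<rho>\<close>, of x] by (simp add: ennreal_mult_divide_eq)
  finally show ?thesis .
qed

lemma ball_avg_ge:
  fixes x :: "real^'n"
  assumes "AE y in lebesgue. y \<in> ball x \<rho> \<longrightarrow> c \<le> f y" "0 < \<rho>"
  shows "ennreal c \<le> ball_avg x \<rho> f"
proof -
  let ?B = "emeasure lebesgue (ball x \<rho>)"
  have "ennreal c = ennreal c * ?B / ?B"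
    using emeasure_lebesgue_ball_neq[OF \<open>0 < \<rho>\<close>, of x] by (simp add: ennreal_mult_divide_eq)
  also have "ennreal c * ?B = (\<integral>\<^sup>+y\<in>ball x \<rho>. ennreal c \<partial>lebesgue)"
    by (simp add: nn_integral_cmult_indicator)
  also have "\<dots> \<le> (\<integral>\<^sup>+y\<in>ball x \<rho>. ennreal (f y) \<partial>lebesgue)"
    using assms(1) by (intro nn_integral_mono_AE) (auto elim!: eventually_mono split: split_indicator intro: ennreal_leI)
  finally show ?thesis
    unfolding ball_avg_def by (simp add: divide_right_mono_ennreal)
qed

text \<open>Points of B(x, \<rho>) have norm at most |x| + \<rho>, and a nonnegative power is
  nondecreasing. The averages below are all measured on the scale |x| + \<rho>, so that its powers
  can cancel.\<close>

lemma ball_avg_power_weight_le_nonneg: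
  fixes x :: "real^'n"
  assumes "0 \<le> a" "0 < \<rho>"
  shows "ball_avg x \<rho> (power_weight a) \<le> ennreal ((norm x + \<rho>) powr a)"
proof (intro ball_avg_le eventually_mono[OF AE_lebesgue_neq[of 0]] impI)
  fix y :: "real^'n" assume "y \<noteq> 0" "y \<in> ball x \<rho>"
  moreover have "norm y \<le> norm x + \<rho>"
    using \<open>y \<in> ball x \<rho>\<close> norm_triangle_ineq2[of y x] by (simp add: dist_norm norm_minus_commute)
  ultimately show "power_weight a y \<le> (norm x + \<rho>) powr a"
    using assms by (simp add: power_weight_def powr_mono2)
qed fact

text \<open>The same bound on norms; a nonpositive power reverses it.\<close>

lemma ball_avg_power_weight_ge:
  fixes x :: "real^'n"
  assumes "a \<le> 0" "0 < \<rho>"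
  shows "ennreal ((norm x + \<rho>) powr a) \<le> ball_avg x \<rho> (power_weight a)"
proof (intro ball_avg_ge eventually_mono[OF AE_lebesgue_neq[of 0]] impI)
  fix y :: "real^'n" assume "y \<noteq> 0" "y \<in> ball x \<rho>"
  moreover have "norm y \<le> norm x + \<rho>"
    using \<open>y \<in> ball x \<rho>\<close> norm_triangle_ineq2[of y x] by (simp add: dist_norm norm_minus_commute)
  ultimately show "(norm x + \<rho>) powr a \<le> power_weight a y"
    using assms by (simp add: power_weight_def powr_mono2')
qed fact

text \<open>If the ball is far from the origin, compared with its radius, the weight is pointwise
  comparable to (|x| + \<rho>)^a on it. Otherwise the ball lies in B(0, 3\<rho>), and the integral
  bound for centred balls is divided by the volume.\<close>

lemma ball_avg_power_weight_le:
  assumes a: "- real CARD('n) < a" "a \<le> 0"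
  obtains K where "0 < K"
    "\<And>(x::real^'n) \<rho>. 0 < \<rho> \<Longrightarrow> ball_avg x \<rho> (power_weight a) \<le> ennreal (K * (norm x + \<rho>) powr a)"
proof -
  define n where "n = CARD('n)"
  define V where "V = unit_ball_vol (real n)"
  have V: "0 < V" by (simp add: V_def)
  obtain K where K: "0 < K"
    "\<And>R. 0 < R \<Longrightarrow> (\<integral>\<^sup>+y\<in>ball 0 R. ennreal (power_weight a (y::real^'n)) \<partial>lebesgue)
              \<le> ennreal (K * R powr (real n + a))"
    using nn_integral_power_weight_ball_le[OF a] unfolding n_def by metis
  \<comment> \<open>The first summand serves the balls far from the origin, the second the balls
    near it.\<close>
  define L where "L = 3 powr - a + K * 3 powr real n / V"
  have L: "3 powr - a \<le> L" "K * 3 powr real n / V \<le> L" "0 < L"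
    using K V by (auto simp: L_def intro: add_pos_pos)
  show ?thesis
  proof
    show "0 < L" by fact
    fix x :: "real^'n" and \<rho> :: real assume \<rho>: "0 < \<rho>"
    show "ball_avg x \<rho> (power_weight a) \<le> ennreal (L * (norm x + \<rho>) powr a)"
    proof (cases "2 * \<rho> \<le> norm x")
      case True
      show ?thesis
      proof (intro ball_avg_le eventually_mono[OF AE_lebesgue_neq[of 0]] impI)
        fix y :: "real^'n" assume y: "y \<noteq> 0" "y \<in> ball x \<rho>"
        have "norm x - norm y < \<rho>"
          using y(2) norm_triangle_ineq2[of x y] by (simp add: dist_norm)
        \<comment> \<open>From 2\<rho> <= |x| one gets |x| - \<rho> >= (|x| + \<rho>) / 3.\<close>
        with True have "(norm x + \<rho>) / 3 \<le> norm y" by simp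
        then have "norm y powr a \<le> ((norm x + \<rho>) / 3) powr a"
          using a \<rho> by (intro powr_mono2') (auto intro: add_nonneg_pos)
        also have "\<dots> = 3 powr - a * (norm x + \<rho>) powr a"
          using \<rho> by (simp add: powr_divide powr_minus_divide)
        also have "\<dots> \<le> L * (norm x + \<rho>) powr a"
          using L by (intro mult_right_mono) auto
        finally show "power_weight a y \<le> L * (norm x + \<rho>) powr a"
          using y by (simp add: power_weight_def)
      qed fact
    next
      case False
      have "ball x \<rho> \<subseteq> ball 0 (3 * \<rho>)"
      proof
        fix y assume "y \<in> ball x \<rho>"
        then show "y \<in> ball 0 (3 * \<rho>)"
          using False norm_triangle_ineq2[of y x] by (simp add: dist_norm norm_minus_commute)
      qed
      then have "(\<integral>\<^sup>+y\<in>ball x \<rho>. ennreal (power_weight a (y::real^'n)) \<partial>lebesgue)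
          \<le> (\<integral>\<^sup>+y\<in>ball 0 (3 * \<rho>). ennreal (power_weight a (y::real^'n)) \<partial>lebesgue)"
        by (intro nn_integral_mono) (auto split: split_indicator)
      also have "\<dots> \<le> ennreal (K * (3 * \<rho>) powr (real n + a))"
        using K \<rho> by simp
      finally have "ball_avg x \<rho> (power_weight a)
          \<le> ennreal (K * (3 * \<rho>) powr (real n + a)) / emeasure lebesgue (ball x \<rho>)"
        unfolding ball_avg_def by (rule divide_right_mono_ennreal)
      also have "\<dots> = ennreal (K * (3 * \<rho>) powr (real n + a) / (V * \<rho> ^ n))"
        using K \<rho> V by (simp add: emeasure_ball divide_ennreal V_def n_def)
      also have "\<dots> \<le> ennreal (L * (norm x + \<rho>) powr a)"
      proof (rule ennreal_leI)
        have "(3 * \<rho>) powr (real n + a) = 3 powr real n * \<rho> powr real n * (3 * \<rho>) powr a"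
          using \<rho> by (simp add: powr_add powr_mult)
        then have "K * (3 * \<rho>) powr (real n + a) / (V * \<rho> ^ n) = K * 3 powr real n / V * (3 * \<rho>) powr a"
          using \<rho> V by (simp add: powr_realpow)
        \<comment> \<open>Here |x| + \<rho> < 3\<rho>, and the power a <= 0 is
          nonincreasing.\<close>
        also have "\<dots> \<le> L * (norm x + \<rho>) powr a"
          using L False a \<rho> by (intro mult_mono powr_mono2') (auto intro: add_nonneg_pos)
        finally show "K * (3 * \<rho>) powr (real n + a) / (V * \<rho> ^ n) \<le> L * (norm x + \<rho>) powr a" .
      qed
      finally show ?thesis .
    qed
  qed
qed

lemma ball_avg_mult_emeasure:
  fixes x :: "real^'n"
  assumes "0 < \<rho>"
  shows "ball_avg x \<rho> f * emeasure lebesgue (ball x \<rho>) = (\<integral>\<^sup>+y\<in>ball x \<rho>. ennreal (f y) \<partial>lebesgue)"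
  unfolding ball_avg_def using emeasure_lebesgue_ball_neq[OF assms, of x]
  by (simp add: ennreal_divide_times ennreal_times_divide ennreal_mult_divide_eq)

text \<open>The integral is the average at the origin times the finite volume of the ball; the
  average is bounded by one of two lemmas according to the sign of a.\<close>

lemma nn_integral_power_weight_ball_finite:
  assumes a: "- real CARD('n) < a" and "0 < R"
  shows "(\<integral>\<^sup>+y\<in>ball 0 R. ennreal (power_weight a (y::real^'n)) \<partial>lebesgue) < \<infinity>"
proof -
  obtain c where "ball_avg (0::real^'n) R (power_weight a) \<le> ennreal c"
    using ball_avg_power_weight_le[OF a] ball_avg_power_weight_le_nonneg[of a R 0] \<open>0 < R\<close>
    by (metis linear)
  then have "ball_avg (0::real^'n) R (power_weight a) * emeasure lebesgue (ball (0::real^'n) R) < \<infinity>"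
    using emeasure_lebesgue_ball_neq(2)[OF \<open>0 < R\<close>, of "0::real^'n"]
      \<open>ball_avg (0::real^'n) R (power_weight a) \<le> ennreal c\<close>[THEN le_less_trans, OF ennreal_less_top]
    by (simp add: ennreal_mult_less_top less_top)
  then show ?thesis
    by (simp only: ball_avg_mult_emeasure[OF \<open>0 < R\<close>])
qed

lemma weight_power_weight:
  assumes a: "- real CARD('n) < a"
  shows "weight (power_weight a :: real^'n \<Rightarrow> real)"
  unfolding weight_def
proof (intro conjI allI impI power_weight_pos)
  fix K :: "(real^'n) set" assume "compact K"
  then obtain R where R: "0 < R" "K \<subseteq> ball 0 R"
    using compact_imp_bounded bounded_subset_ballD by blast
  have "(\<integral>\<^sup>+y\<in>K. ennreal (power_weight a y) \<partial>lebesgue) \<le> (\<integral>\<^sup>+y\<in>ball 0 R. ennreal (power_weight a (y::real^'n)) \<partial>lebesgue)"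
    using R by (intro nn_integral_mono) (auto split: split_indicator)
  also have "\<dots> < \<infinity>"
    using nn_integral_power_weight_ball_finite[OF a \<open>0 < R\<close>] .
  finally have fin: "(\<integral>\<^sup>+y\<in>K. ennreal (power_weight a y) \<partial>lebesgue) < \<infinity>" .
  have [measurable]: "K \<in> sets lebesgue"
    using \<open>compact K\<close> by (simp add: borel_compact)
  have "(\<integral>\<^sup>+y. ennreal (indicator K y * power_weight a y) \<partial>lebesgue) < \<infinity>"
  proof -
    have "ennreal (indicator K y * power_weight a y) = ennreal (power_weight a y) * indicator K y" for y
      by (simp split: split_indicator)
    with fin show ?thesis by simp
  qed
  then show "set_integrable lebesgue K (power_weight a)"
    unfolding set_integrable_def
    by (intro integrableI_nonneg) (auto simp: power_weight_pos less_imp_le)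
qed

section \<open>Power weights in the Muckenhoupt and reverse Hoelder classes\<close>

lemma epowr_ennreal: "0 \<le> x \<Longrightarrow> ennreal x epowr a = ennreal (x powr a)"
  by (simp add: enn_powr_def)

lemma epowr_mono:
  assumes "x \<le> y" "0 \<le> a"
  shows "x epowr a \<le> y epowr a"
  using assms
  by (cases x; cases y) (auto simp: enn_powr_def powr_mono2 top_unique)

lemma zero_epowr [simp]: "0 epowr a = 0"
  by (simp add: enn_powr_def)

text \<open>For r > 1 the dual weight is the power weight with exponent -a / (r - 1), and a < n(r -
  1) says that this exponent exceeds -n. Both averages are then bounded by powers of |x| + \<rho>
  whose product is constant. For r = 1 only a = 0 remains, the constant weight.\<close>

lemma power_weight_in_muckenhoupt:
  assumes "1 \<le> r" "0 \<le> a" "a < real CARD('n) * (r - 1) \<or> a = 0"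
  shows "(power_weight a :: real^'n \<Rightarrow> real) \<in> muckenhoupt r"
proof -
  have w: "weight (power_weight a :: real^'n \<Rightarrow> real)"
    using assms by (intro weight_power_weight) (auto intro: less_le_trans[of _ 0])
  show ?thesis
  proof (cases "r = 1")
    case True
    with assms have [simp]: "a = 0" by auto
    have [simp]: "power_weight 0 = (\<lambda>x::real^'n. 1)"
      by (auto simp: power_weight_def)
    have "ball_avg x \<rho> (\<lambda>x. 1) \<le> ennreal (1 * 1)" if "0 < \<rho>" for x :: "real^'n" and \<rho>
      using ball_avg_le[of x \<rho> "\<lambda>_. 1" 1] that by simp
    then show ?thesis
      using w True unfolding muckenhoupt_def by (auto intro!: exI[of _ 1])
  next
    case False
    with assms have r: "1 < r" by simp
    \<comment> \<open>Here 1 - r / (r - 1) = -1 / (r - 1), the exponent of the dual weight.\<close>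
    define b where "b = a * (1 - r / (r - 1))"
    have b_eq: "b = - a / (r - 1)"
      using r by (simp add: b_def field_simps)
    have b: "- real CARD('n) < b" "b \<le> 0"
      using r assms by (auto simp: b_eq field_simps)
    obtain K where K: "0 < K"
      "\<And>(x::real^'n) \<rho>. 0 < \<rho> \<Longrightarrow> ball_avg x \<rho> (power_weight b) \<le> ennreal (K * (norm x + \<rho>) powr b)"
      using ball_avg_power_weight_le[OF b] by metis
    have "ball_avg x \<rho> (power_weight a) * ball_avg x \<rho> (\<lambda>y. power_weight a y powr (1 - r / (r - 1))) epowr (r - 1)
         \<le> ennreal (K powr (r - 1))" if \<rho>: "0 < \<rho>" for x :: "real^'n" and \<rho>
    proof -
      have d: "0 < norm x + \<rho>" using \<rho> by (simp add: add_nonneg_pos)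
      have "ball_avg x \<rho> (power_weight a) * ball_avg x \<rho> (\<lambda>y. power_weight a y powr (1 - r / (r - 1))) epowr (r - 1)
          \<le> ennreal ((norm x + \<rho>) powr a) * ennreal (K * (norm x + \<rho>) powr b) epowr (r - 1)"
        using K \<rho> r assms
        by (intro mult_mono epowr_mono ball_avg_power_weight_le_nonneg) (auto simp: power_weight_powr b_def[symmetric])
      also have "\<dots> = ennreal ((norm x + \<rho>) powr a * (K * (norm x + \<rho>) powr b) powr (r - 1))"
        using K by (simp add: epowr_ennreal ennreal_mult[symmetric])
      also have "(norm x + \<rho>) powr a * (K * (norm x + \<rho>) powr b) powr (r - 1)
          = K powr (r - 1) * ((norm x + \<rho>) powr a * (norm x + \<rho>) powr (b * (r - 1)))"
        using K by (simp add: powr_mult powr_powr)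
      also have "(norm x + \<rho>) powr a * (norm x + \<rho>) powr (b * (r - 1)) = 1"
        using r d by (simp add: powr_add[symmetric] b_eq)
      finally show ?thesis by simp
    qed
    then show ?thesis
      using w False unfolding muckenhoupt_def by auto
  qed
qed

text \<open>With q = s' the condition on a < 0 reads aq > -n, so the average of the q-th power is at
  most a multiple of (|x| + \<rho>)^(aq). Its q-th root is controlled by the average of the weight
  itself, which is at least (|x| + \<rho>)^a. For s = 1 only the constant weight remains.\<close>

lemma power_weight_in_reverse_hoelder:
  assumes "1 \<le> s" "a \<le> 0" "- real CARD('n) * (s - 1) / s < a \<or> a = 0"
  shows "(power_weight a :: real^'n \<Rightarrow> real) \<in> reverse_hoelder (conj_exp s)"
proof -
  have "- real CARD('n) < - real CARD('n) * (s - 1) / s"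
    using assms(1) by (simp add: field_simps)
  with assms have an: "- real CARD('n) < a" by fastforce
  have w: "weight (power_weight a :: real^'n \<Rightarrow> real)"
    using an by (rule weight_power_weight)
  show ?thesis
  proof (cases "s = 1")
    case True
    with assms have [simp]: "a = 0" by auto
    have [simp]: "power_weight 0 = (\<lambda>x::real^'n. 1)"
      by (auto simp: power_weight_def)
    have "1 \<le> ball_avg x \<rho> (\<lambda>x. 1)" if "0 < \<rho>" for x :: "real^'n" and \<rho>
      using ball_avg_ge[of x \<rho> 1 "\<lambda>_. 1"] that by simp
    then show ?thesis
      using w True unfolding reverse_hoelder_def conj_exp_def by (auto intro!: exI[of _ 1])
  next
    case False
    with assms have s: "1 < s" by simp
    define q where "q = s / (s - 1)"
    have q: "0 < q" using s by (simp add: q_def)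
    have b: "- real CARD('n) < a * q" "a * q \<le> 0"
      using s assms q by (auto simp: q_def field_simps mult_le_0_iff)
    obtain K where K: "0 < K"
      "\<And>(x::real^'n) \<rho>. 0 < \<rho> \<Longrightarrow> ball_avg x \<rho> (power_weight (a * q)) \<le> ennreal (K * (norm x + \<rho>) powr (a * q))"
      using ball_avg_power_weight_le[OF b] by metis
    have "ball_avg x \<rho> (\<lambda>y. power_weight a y powr q) epowr (1 / q)
         \<le> ennreal (K powr (1 / q)) * ball_avg x \<rho> (power_weight a)" if \<rho>: "0 < \<rho>" for x :: "real^'n" and \<rho>
    proof -
      have "ball_avg x \<rho> (\<lambda>y. power_weight a y powr q) epowr (1 / q)
          \<le> ennreal (K * (norm x + \<rho>) powr (a * q)) epowr (1 / q)"
        using K \<rho> q by (intro epowr_mono) (auto simp: power_weight_powr)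
      also have "\<dots> = ennreal (K powr (1 / q)) * ennreal ((norm x + \<rho>) powr a)"
        using K q by (simp add: epowr_ennreal ennreal_mult[symmetric] powr_mult powr_powr)
      also have "\<dots> \<le> ennreal (K powr (1 / q)) * ball_avg x \<rho> (power_weight a)"
        using assms \<rho> by (intro mult_left_mono ball_avg_power_weight_ge) auto
      finally show ?thesis .
    qed
    then show ?thesis
      using w False q unfolding reverse_hoelder_def conj_exp_def q_def[symmetric] by auto
  qed
qed

section \<open>The test function and its area functionals\<close>

text \<open>Heights in this ball lie between 1 and 2, which keeps 1 / t^(n+1) between two positive
  constants.\<close>

definition test_ball :: "((real^'n) \<times> real) set" where
  "test_ball = ball (0, 3/2) (1/2)"

lemma test_ballD:
  fixes y :: "real^'n"
  assumes "(y, t) \<in> test_ball"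
  shows "norm y < 1/2" "1 < t" "t < 2"
proof -
  have d: "dist ((0::real^'n), 3/2) (y, t) < (1/2 :: real)"
    using assms by (simp add: test_ball_def)
  show "norm y < 1/2"
    using dist_fst_le[of "((0::real^'n), 3/2::real)" "(y,t)"] d by simp
  have "\<bar>3/2 - t\<bar> < 1/2"
    using dist_snd_le[of "((0::real^'n), 3/2::real)" "(y,t)"] d by (simp add: dist_real_def)
  then show "1 < t" "t < 2" by linarith+
qed

text \<open>A cone that meets the test ball has its vertex in B(0, 3\<alpha>), and a cone with
  vertex in B(0, \<alpha>/2) contains the whole test ball. The constants depend only on the measure
  of the test ball and on n, not on \<alpha>.\<close>

lemma area_fun_test_ball_bounds:
  obtains c C where "0 < c" "0 < C"
    "\<And>\<alpha> x. 1 \<le> \<alpha> \<Longrightarrow> area_fun \<alpha> (indicator test_ball) (x::real^'n) \<le> ennreal C * indicator (ball 0 (3 * \<alpha>)) x"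
    "\<And>\<alpha> x. 1 \<le> \<alpha> \<Longrightarrow> x \<in> ball 0 (\<alpha> / 2) \<Longrightarrow> ennreal c \<le> area_fun \<alpha> (indicator test_ball) (x::real^'n)"
proof
  define n where "n = CARD('n)"
  define M where "M = measure lebesgue (test_ball :: ((real^'n) \<times> real) set)"
  have M: "emeasure lebesgue (test_ball :: ((real^'n) \<times> real) set) = ennreal M" "0 < M"
    unfolding M_def test_ball_def measure_def by (auto simp: emeasure_ball)
  have [measurable]: "(test_ball :: ((real^'n) \<times> real) set) \<in> sets lebesgue"
    by (simp add: test_ball_def)
  let ?I = "\<lambda>\<alpha> (x::real^'n). \<integral>\<^sup>+(y, t)\<in>cone \<alpha> x.
     ennreal ((norm (indicator test_ball (y, t) :: complex))\<^sup>2 / t ^ (CARD('n) + 1)) \<partial>lebesgue"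
  \<comment> \<open>The density 1 / t^(n+1) is at least 1 / 2^(n+1) on the test ball, as t <
    2.\<close>
  define m where "m = 1 / 2 ^ (n + 1) * M"
  have m: "0 < m" using M by (simp add: m_def)
  show "0 < m powr (1/2)" "0 < M powr (1/2)" using M m by auto
  fix \<alpha> :: real and x :: "real^'n"
  show "area_fun \<alpha> (indicator test_ball) x \<le> ennreal (M powr (1/2)) * indicator (ball 0 (3 * \<alpha>)) x" if \<alpha>: "1 \<le> \<alpha>"
  proof -
    have "?I \<alpha> x \<le> (\<integral>\<^sup>+z. indicator (ball 0 (3 * \<alpha>)) x * indicator test_ball (z :: (real^'n) \<times> real) \<partial>lebesgue)"
    proof (intro nn_integral_mono, simp only: split_paired_all prod.case)
      fix y :: "real^'n" and t :: real
      show "ennreal ((norm (indicator test_ball (y, t) :: complex))\<^sup>2 / t ^ (CARD('n) + 1)) * indicator (cone \<alpha> x) (y, t)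
          \<le> indicator (ball 0 (3 * \<alpha>)) x * indicator test_ball (y, t)"
      proof (cases "(y, t) \<in> test_ball \<and> (y, t) \<in> cone \<alpha> x")
        case True
        then have t: "norm y < 1/2" "1 < t" "t < 2" using test_ballD by blast+
        have "norm (x - y) < \<alpha> * t" using True by (simp add: cone_def)
        also have "\<dots> \<le> \<alpha> * 2" using t \<alpha> by (intro mult_left_mono) auto
        \<comment> \<open>By the triangle inequality |x| < 2\<alpha> + 1/2, and 1/2 <
          \<alpha>.\<close>
        finally have "norm x < 3 * \<alpha>"
          using t \<alpha> norm_triangle_ineq2[of x y] by linarith
        moreover have "1 / t ^ (CARD('n) + 1) \<le> 1"
          using t one_le_power[of t "CARD('n) + 1"] by (simp add: divide_le_eq del: power_Suc)
        ultimately show ?thesis using True by (simp del: power_Suc)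
      next
        case False
        then show ?thesis by (auto split: split_indicator)
      qed
    qed
    also have "\<dots> = indicator (ball 0 (3 * \<alpha>)) x * ennreal M"
      by (simp add: nn_integral_cmult M)
    finally have "area_fun \<alpha> (indicator test_ball) x \<le> (indicator (ball 0 (3 * \<alpha>)) x * ennreal M) epowr (1/2)"
      unfolding area_fun_def by (rule epowr_mono) simp
    then show ?thesis
      using M by (auto simp: epowr_ennreal split: split_indicator_asm split_indicator)
  qed
  show "ennreal (m powr (1/2)) \<le> area_fun \<alpha> (indicator test_ball) x" if \<alpha>: "1 \<le> \<alpha>" and x: "x \<in> ball 0 (\<alpha> / 2)"
  proof -
    have nx: "norm x < \<alpha> / 2" using x by simp
    have "ennreal m = (\<integral>\<^sup>+z. ennreal (1 / 2 ^ (n + 1)) * indicator test_ball (z :: (real^'n) \<times> real) \<partial>lebesgue)"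
      using M by (simp add: nn_integral_cmult m_def ennreal_mult[symmetric])
    also have "\<dots> \<le> ?I \<alpha> x"
    proof (intro nn_integral_mono, simp only: split_paired_all prod.case)
      fix y :: "real^'n" and t :: real
      show "ennreal (1 / 2 ^ (n + 1)) * indicator test_ball (y, t)
          \<le> ennreal ((norm (indicator test_ball (y, t) :: complex))\<^sup>2 / t ^ (CARD('n) + 1)) * indicator (cone \<alpha> x) (y, t)"
      proof (cases "(y, t) \<in> test_ball")
        case True
        then have t: "norm y < 1/2" "1 < t" "t < 2" using test_ballD by blast+
        \<comment> \<open>Both |x| < \<alpha>/2 and |y| < 1/2 <= \<alpha>/2 are used.\<close>
        have "norm (x - y) < \<alpha>"
          using \<alpha> nx t norm_triangle_ineq4[of x y] by linarith
        also have "\<alpha> \<le> \<alpha> * t"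
          using \<alpha> t by simp
        finally have "(y, t) \<in> cone \<alpha> x"
          using t by (simp add: cone_def upper_half_def)
        moreover have "1 / 2 ^ (n + 1) \<le> 1 / t ^ (CARD('n) + 1)"
          using t by (auto simp: n_def intro!: divide_left_mono power_mono simp del: power_Suc)
        ultimately show ?thesis
          using True by (simp add: ennreal_leI n_def del: power_Suc)
      qed simp
    qed
    finally have "ennreal m epowr (1/2) \<le> area_fun \<alpha> (indicator test_ball) x"
      unfolding area_fun_def by (rule epowr_mono) simp
    then show ?thesis
      using m by (simp add: epowr_ennreal)
  qed
qed

section \<open>Weighted norms and growth of the weighted measure\<close>

lemma powr_mult_epowr:
  assumes "0 \<le> x" "0 \<le> m" "0 < p"
  shows "(ennreal (x powr p) * ennreal m) epowr (1/p) = ennreal (x * m powr (1/p))"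
  using assms by (simp add: epowr_ennreal ennreal_mult[symmetric] powr_mult powr_powr)

text \<open>Reduces the norm to the weighted measure of S. Monotonicity of the integral applies to
  arbitrary g, so the area functional can be inserted directly.\<close>

lemma weighted_Lp_le:
  fixes g :: "real^'n \<Rightarrow> ennreal"
  assumes [measurable]: "S \<in> sets lebesgue" "w \<in> borel_measurable lebesgue" and "0 < p" "0 \<le> C" "0 \<le> M"
    and g: "\<And>x. g x \<le> ennreal C * indicator S x"
    and w: "(\<integral>\<^sup>+x\<in>S. ennreal (w x) \<partial>lebesgue) \<le> ennreal M"
  shows "weighted_Lp p w g \<le> ennreal (C * M powr (1/p))"
proof -
  have "g x epowr p * ennreal (w x) \<le> ennreal (C powr p) * (ennreal (w x) * indicator S x)" for x
  proof (cases "x \<in> S")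
    case True
    then have "g x epowr p \<le> ennreal C epowr p"
      using g[of x] \<open>0 < p\<close> by (intro epowr_mono) auto
    then show ?thesis
      using True \<open>0 \<le> C\<close> by (simp add: epowr_ennreal mult_right_mono)
  qed (use g[of x] in simp)
  then have "(\<integral>\<^sup>+x. g x epowr p * ennreal (w x) \<partial>lebesgue)
      \<le> (\<integral>\<^sup>+x. ennreal (C powr p) * (ennreal (w x) * indicator S x) \<partial>lebesgue)"
    by (intro nn_integral_mono)
  also have "\<dots> = ennreal (C powr p) * (\<integral>\<^sup>+x\<in>S. ennreal (w x) \<partial>lebesgue)"
    by (intro nn_integral_cmult) measurable
  also have "\<dots> \<le> ennreal (C powr p) * ennreal M"
    by (intro mult_left_mono w) simp
  finally have "weighted_Lp p w g \<le> (ennreal (C powr p) * ennreal M) epowr (1/p)"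
    unfolding weighted_Lp_def using \<open>0 < p\<close> by (intro epowr_mono) auto
  then show ?thesis
    using assms by (simp add: powr_mult_epowr)
qed

lemma weighted_Lp_ge:
  fixes g :: "real^'n \<Rightarrow> ennreal"
  assumes [measurable]: "S \<in> sets lebesgue" "w \<in> borel_measurable lebesgue" and "0 < p" "0 \<le> c" "0 \<le> m"
    and g: "\<And>x. x \<in> S \<Longrightarrow> ennreal c \<le> g x"
    and w: "ennreal m \<le> (\<integral>\<^sup>+x\<in>S. ennreal (w x) \<partial>lebesgue)"
  shows "ennreal (c * m powr (1/p)) \<le> weighted_Lp p w g"
proof -
  have le: "ennreal (c powr p) * (ennreal (w x) * indicator S x) \<le> g x epowr p * ennreal (w x)" for x
  proof (cases "x \<in> S")
    case True
    then have "ennreal c epowr p \<le> g x epowr p"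
      using g[of x] \<open>0 < p\<close> by (intro epowr_mono) auto
    then show ?thesis
      using True \<open>0 \<le> c\<close> by (simp add: epowr_ennreal mult_right_mono)
  qed simp
  have "ennreal (c powr p) * ennreal m \<le> ennreal (c powr p) * (\<integral>\<^sup>+x\<in>S. ennreal (w x) \<partial>lebesgue)"
    by (intro mult_left_mono w) simp
  also have "\<dots> = (\<integral>\<^sup>+x. ennreal (c powr p) * (ennreal (w x) * indicator S x) \<partial>lebesgue)"
    by (intro nn_integral_cmult[symmetric]) measurable
  also have "\<dots> \<le> (\<integral>\<^sup>+x. g x epowr p * ennreal (w x) \<partial>lebesgue)"
    by (intro nn_integral_mono le)
  finally have "(ennreal (c powr p) * ennreal m) epowr (1/p) \<le> weighted_Lp p w g"
    unfolding weighted_Lp_def using \<open>0 < p\<close> by (intro epowr_mono) auto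
  then show ?thesis
    using assms by (simp add: powr_mult_epowr)
qed

text \<open>The outer half R/2 < |y| < R already carries enough mass: the weight is at least (R/2)^a
  there, and a ball of radius R/4 fits inside.\<close>

lemma nn_integral_power_weight_ball_ge:
  assumes "0 \<le> a"
  obtains k where "0 < k"
    "\<And>R. 0 < R \<Longrightarrow> ennreal (k * R powr (real CARD('n) + a))
        \<le> (\<integral>\<^sup>+y\<in>ball 0 R. ennreal (power_weight a (y::real^'n)) \<partial>lebesgue)"
proof
  define n where "n = CARD('n)"
  define V where "V = unit_ball_vol (real n)"
  have V: "0 < V" by (simp add: V_def)
  let ?k = "(1/2) powr a * V * (1/4) ^ n"
  show "0 < ?k" using V by simp
  fix R :: real assume R: "0 < R"
  \<comment> \<open>The middle radius 3R/4 leaves R/4 to both sides of the shell.\<close>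
  obtain e :: "real^'n" where e: "norm e = 3/4 * R"
    using vector_choose_size[of "3/4 * R"] R by auto
  have sub: "norm y < R \<and> R / 2 < norm y" if "y \<in> ball e (R/4)" for y
    using that e norm_triangle_ineq2[of y e] norm_triangle_ineq2[of e y]
    by (auto simp: dist_norm norm_minus_commute)
  have "?k * R powr (real n + a) = (R/2) powr a * (V * (R/4) ^ n)"
    using R by (simp add: powr_add powr_realpow powr_divide power_divide)
  also have "ennreal \<dots> = (\<integral>\<^sup>+y. ennreal ((R/2) powr a) * indicator (ball e (R/4)) y \<partial>lebesgue)"
    using R V by (simp add: nn_integral_cmult_indicator emeasure_ball ennreal_mult V_def n_def)
  also have "\<dots> \<le> (\<integral>\<^sup>+y\<in>ball 0 R. ennreal (power_weight a (y::real^'n)) \<partial>lebesgue)"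
  proof (intro nn_integral_mono)
    fix y
    show "ennreal ((R/2) powr a) * indicator (ball e (R/4)) y \<le> ennreal (power_weight a y) * indicator (ball 0 R) y"
    proof (cases "y \<in> ball e (R/4)")
      case True
      then show ?thesis
        using sub[OF True] R assms by (auto simp: power_weight_def intro!: ennreal_leI powr_mono2)
    qed simp
  qed
  finally show "ennreal (?k * R powr (real CARD('n) + a))
        \<le> (\<integral>\<^sup>+y\<in>ball 0 R. ennreal (power_weight a (y::real^'n)) \<partial>lebesgue)"
    by (simp add: n_def)
qed

lemma powr_unbounded:
  fixes A B e :: real
  assumes "0 < A" "0 < e"
  obtains \<alpha> where "1 \<le> \<alpha>" "B < A * \<alpha> powr e"
proof
  define b where "b = max 1 (B / A + 1)"
  have "1 \<le> b" "B / A < b" by (auto simp: b_def)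
  then show "1 \<le> b powr (1 / e)" "B < A * (b powr (1 / e)) powr e"
    using assms by (auto simp: powr_powr ge_one_powr_ge_zero field_simps)
qed

lemma test_function_measurable:
  "(indicator test_ball :: (real^'n) \<times> real \<Rightarrow> complex) \<in> borel_measurable (lebesgue_on upper_half)"
proof (rule measurable_restrict_space1)
  have [measurable]: "(test_ball :: ((real^'n) \<times> real) set) \<in> sets lebesgue"
    by (simp add: test_ball_def)
  show "(indicator test_ball :: (real^'n) \<times> real \<Rightarrow> complex) \<in> borel_measurable lebesgue"
    by measurable
qed

section \<open>Sharp growth exponents for a fixed power weight\<close>

text \<open>For the test function the left side is at least a positive multiple of
  \<alpha>^((n+a)/p), while the norm with aperture 1 is a finite constant. A smaller exponent e
  therefore fails as \<alpha> grows.\<close>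

lemma area_fun_upper_exponent_sharp:
  assumes "0 < p" "0 \<le> a" "e < (real CARD('n) + a) / p"
  shows "\<not> (\<exists>C>0. \<forall>\<alpha>\<ge>1. \<forall>F \<in> borel_measurable (lebesgue_on upper_half).
           weighted_Lp p (power_weight a :: real^'n \<Rightarrow> real) (area_fun \<alpha> F)
             \<le> ennreal (C * \<alpha> powr e) * weighted_Lp p (power_weight a) (area_fun 1 F))"
proof
  let ?w = "power_weight a :: real^'n \<Rightarrow> real"
  let ?F = "indicator test_ball :: (real^'n) \<times> real \<Rightarrow> complex"
  assume "\<exists>C>0. \<forall>\<alpha>\<ge>1. \<forall>F \<in> borel_measurable (lebesgue_on upper_half).
           weighted_Lp p ?w (area_fun \<alpha> F) \<le> ennreal (C * \<alpha> powr e) * weighted_Lp p ?w (area_fun 1 F)"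
  then obtain C0 where C0: "0 < C0" and H: "\<forall>\<alpha>\<ge>1. \<forall>F \<in> borel_measurable (lebesgue_on upper_half).
           weighted_Lp p ?w (area_fun \<alpha> F) \<le> ennreal (C0 * \<alpha> powr e) * weighted_Lp p ?w (area_fun 1 F)"
    by blast
  have bound: "weighted_Lp p ?w (area_fun \<alpha> ?F) \<le> ennreal (C0 * \<alpha> powr e) * weighted_Lp p ?w (area_fun 1 ?F)"
    if "1 \<le> \<alpha>" for \<alpha>
    by (rule H[rule_format, OF that test_function_measurable])
  obtain c C where cC: "0 < c" "0 < C"
    "\<And>\<alpha> x. 1 \<le> \<alpha> \<Longrightarrow> area_fun \<alpha> ?F x \<le> ennreal C * indicator (ball 0 (3 * \<alpha>)) x"
    "\<And>\<alpha> x. 1 \<le> \<alpha> \<Longrightarrow> x \<in> ball 0 (\<alpha> / 2) \<Longrightarrow> ennreal c \<le> area_fun \<alpha> ?F x"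
    by (rule area_fun_test_ball_bounds, rule that) assumption+
  obtain k where k: "0 < k" "\<And>R. 0 < R \<Longrightarrow> ennreal (k * R powr (real CARD('n) + a))
        \<le> (\<integral>\<^sup>+y\<in>ball 0 R. ennreal (?w y) \<partial>lebesgue)"
    by (rule nn_integral_power_weight_ball_ge[where 'n = 'n, OF \<open>0 \<le> a\<close>], rule that) assumption+
  have "0 < real CARD('n)" by simp
  then have "- real CARD('n) < a" using \<open>0 \<le> a\<close> by linarith
  then obtain M where M: "0 \<le> M" "(\<integral>\<^sup>+y\<in>ball 0 3. ennreal (?w y) \<partial>lebesgue) = ennreal M"
    using nn_integral_power_weight_ball_finite[of a 3] by (auto simp: less_top_ennreal)
  have up: "weighted_Lp p ?w (area_fun 1 ?F) \<le> ennreal (C * M powr (1/p))"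
    using M cC(2) cC(3)[of 1] \<open>0 < p\<close> by (intro weighted_Lp_le[where S = "ball 0 3"]) auto
  define d where "d = (real CARD('n) + a) / p"
  \<comment> \<open>The factor \<open>(1/2) powr (real CARD('n) + a)\<close> comes from the radius
    \<alpha>/2 on which the area functional is bounded below.\<close>
  define A where "A = c * (k * (1/2) powr (real CARD('n) + a)) powr (1/p)"
  define B where "B = C0 * (C * M powr (1/p))"
  have "A * \<alpha> powr (d - e) \<le> B" if \<alpha>: "1 \<le> \<alpha>" for \<alpha>
  proof -
    have "ennreal (c * (k * (\<alpha>/2) powr (real CARD('n) + a)) powr (1/p)) \<le> weighted_Lp p ?w (area_fun \<alpha> ?F)"
      using k(1) k(2)[of "\<alpha>/2"] cC(1) cC(4)[OF \<alpha>] \<open>0 < p\<close> \<alpha> by (intro weighted_Lp_ge[where S = "ball 0 (\<alpha>/2)"]) auto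
    also note bound[OF \<alpha>]
    also have "ennreal (C0 * \<alpha> powr e) * weighted_Lp p ?w (area_fun 1 ?F)
        \<le> ennreal (C0 * \<alpha> powr e) * ennreal (C * M powr (1/p))"
      by (rule mult_left_mono[OF up]) simp
    also have "\<dots> = ennreal (B * \<alpha> powr e)"
      using C0 cC by (simp add: ennreal_mult[symmetric] B_def mult_ac)
    also have "c * (k * (\<alpha>/2) powr (real CARD('n) + a)) powr (1/p) = A * \<alpha> powr d"
      using \<alpha> k by (simp add: A_def d_def powr_divide powr_mult powr_powr)
    finally have "A * \<alpha> powr d \<le> B * \<alpha> powr e"
      using C0 cC M by (subst (asm) ennreal_le_iff) (auto simp: B_def)
    then show ?thesis
      using \<alpha> by (simp add: powr_diff field_simps)
  qed
  moreover have "0 < A" "0 < d - e" using cC k assms(3) by (auto simp: A_def d_def)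
  ultimately show False
    using powr_unbounded[of A "d - e" B] by (metis not_le)
qed

text \<open>The roles are exchanged: the norm with aperture 1 is bounded below by a positive
  constant, and the norm with aperture \<alpha> is at most a multiple of \<alpha>^((n+a)/p). If e +
  (n+a)/p < 0, the right side tends to 0.\<close>

lemma area_fun_lower_exponent_sharp:
  assumes "0 < p" and a: "- real CARD('n) < a" "a \<le> 0" and e: "e < - ((real CARD('n) + a) / p)"
  shows "\<not> (\<exists>C>0. \<forall>\<alpha>\<ge>1. \<forall>F \<in> borel_measurable (lebesgue_on upper_half).
           weighted_Lp p (power_weight a :: real^'n \<Rightarrow> real) (area_fun 1 F)
             \<le> ennreal (C * \<alpha> powr e) * weighted_Lp p (power_weight a) (area_fun \<alpha> F))"
proof
  let ?w = "power_weight a :: real^'n \<Rightarrow> real"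
  let ?F = "indicator test_ball :: (real^'n) \<times> real \<Rightarrow> complex"
  assume "\<exists>C>0. \<forall>\<alpha>\<ge>1. \<forall>F \<in> borel_measurable (lebesgue_on upper_half).
           weighted_Lp p ?w (area_fun 1 F) \<le> ennreal (C * \<alpha> powr e) * weighted_Lp p ?w (area_fun \<alpha> F)"
  then obtain C0 where C0: "0 < C0" and H: "\<forall>\<alpha>\<ge>1. \<forall>F \<in> borel_measurable (lebesgue_on upper_half).
           weighted_Lp p ?w (area_fun 1 F) \<le> ennreal (C0 * \<alpha> powr e) * weighted_Lp p ?w (area_fun \<alpha> F)"
    by blast
  have bound: "weighted_Lp p ?w (area_fun 1 ?F) \<le> ennreal (C0 * \<alpha> powr e) * weighted_Lp p ?w (area_fun \<alpha> ?F)"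
    if "1 \<le> \<alpha>" for \<alpha>
    by (rule H[rule_format, OF that test_function_measurable])
  obtain c C where cC: "0 < c" "0 < C"
    "\<And>\<alpha> x. 1 \<le> \<alpha> \<Longrightarrow> area_fun \<alpha> ?F x \<le> ennreal C * indicator (ball 0 (3 * \<alpha>)) x"
    "\<And>\<alpha> x. 1 \<le> \<alpha> \<Longrightarrow> x \<in> ball 0 (\<alpha> / 2) \<Longrightarrow> ennreal c \<le> area_fun \<alpha> ?F x"
    by (rule area_fun_test_ball_bounds, rule that) assumption+
  obtain K where K: "0 < K" "\<And>R. 0 < R \<Longrightarrow> (\<integral>\<^sup>+y\<in>ball 0 R. ennreal (?w y) \<partial>lebesgue)
        \<le> ennreal (K * R powr (real CARD('n) + a))"
    by (rule nn_integral_power_weight_ball_le[OF a], rule that) assumption+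
  \<comment> \<open>Lower bound for the weighted measure of B(0, 1/2): the smallest value of the
    power on it, (1/2)^a, times its volume.\<close>
  define m where "m = (1/2) powr a * (unit_ball_vol (real CARD('n)) * (1/2) ^ CARD('n))"
  have m: "0 < m" by (simp add: m_def)
  have "ennreal m = ennreal ((norm (0::real^'n) + 1/2) powr a) * emeasure lebesgue (ball (0::real^'n) (1/2))"
    by (simp add: m_def emeasure_ball ennreal_mult[symmetric])
  also have "\<dots> \<le> ball_avg 0 (1/2) ?w * emeasure lebesgue (ball (0::real^'n) (1/2))"
    using a by (intro mult_right_mono ball_avg_power_weight_ge) auto
  finally have "ennreal m \<le> (\<integral>\<^sup>+y\<in>ball 0 (1/2). ennreal (?w y) \<partial>lebesgue)"
    by (simp only: ball_avg_mult_emeasure zero_less_divide_1_iff zero_less_numeral)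
  then have low: "ennreal (c * m powr (1/p)) \<le> weighted_Lp p ?w (area_fun 1 ?F)"
    using m cC(1) cC(4)[of 1] \<open>0 < p\<close> by (intro weighted_Lp_ge[where S = "ball 0 (1/2)"]) auto
  define d where "d = (real CARD('n) + a) / p"
  define A where "A = c * m powr (1/p)"
  define B where "B = C0 * (C * (K * 3 powr (real CARD('n) + a)) powr (1/p))"
  have "A * \<alpha> powr (- d - e) \<le> B" if \<alpha>: "1 \<le> \<alpha>" for \<alpha>
  proof -
    have up: "weighted_Lp p ?w (area_fun \<alpha> ?F) \<le> ennreal (C * (K * (3*\<alpha>) powr (real CARD('n) + a)) powr (1/p))"
      using K(1) K(2)[of "3*\<alpha>"] cC(2) cC(3)[OF \<alpha>] \<open>0 < p\<close> \<alpha> by (intro weighted_Lp_le[where S = "ball 0 (3*\<alpha>)"]) auto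
    note low[folded A_def]
    also note bound[OF \<alpha>]
    also have "ennreal (C0 * \<alpha> powr e) * weighted_Lp p ?w (area_fun \<alpha> ?F)
        \<le> ennreal (C0 * \<alpha> powr e) * ennreal (C * (K * (3*\<alpha>) powr (real CARD('n) + a)) powr (1/p))"
      by (rule mult_left_mono[OF up]) simp
    also have "\<dots> = ennreal ((C0 * \<alpha> powr e) * (C * (K * (3*\<alpha>) powr (real CARD('n) + a)) powr (1/p)))"
      using C0 cC by (simp add: ennreal_mult)
    also have "(C0 * \<alpha> powr e) * (C * (K * (3*\<alpha>) powr (real CARD('n) + a)) powr (1/p)) = B * (\<alpha> powr e * \<alpha> powr d)"
      using \<alpha> K by (simp add: B_def d_def powr_mult powr_powr)
    finally have "A \<le> B * (\<alpha> powr e * \<alpha> powr d)"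
      using C0 cC K by (subst (asm) ennreal_le_iff) (auto simp: B_def)
    then show ?thesis
      using \<alpha> by (simp add: powr_diff powr_minus field_simps)
  qed
  moreover have "0 < A" "0 < - d - e" using cC m e by (auto simp: A_def d_def)
  ultimately show False
    using powr_unbounded[of A "- d - e" B] by (metis not_le)
qed

section \<open>Choice of the power weight for a given gain in the exponent\<close>

theorem mainTheorem6:
  shows "(\<forall>r p :: real. 1 \<le> r \<longrightarrow> 0 < p \<longrightarrow> p \<le> 2 * r \<longrightarrow>
           \<not> (\<exists>\<rho>::real. 0 < \<rho> \<and> \<rho> < real CARD('n) * r / p \<and>
               (\<forall>w :: real^'n \<Rightarrow> real. w \<in> muckenhoupt r \<longrightarrow>
                 (\<exists>C>0. \<forall>\<alpha>\<ge>1. \<forall>F \<in> borel_measurable (lebesgue_on upper_half).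
                    weighted_Lp p w (area_fun \<alpha> F)
                      \<le> ennreal (C * \<alpha> powr (real CARD('n) * r / p - \<rho>))
                          * weighted_Lp p w (area_fun 1 F)))))
       \<and> (\<forall>s p :: real. 1 \<le> s \<longrightarrow> 2 / s \<le> p \<longrightarrow>
           \<not> (\<exists>\<rho>::real. 0 < \<rho> \<and>
               (\<forall>w :: real^'n \<Rightarrow> real. w \<in> reverse_hoelder (conj_exp s) \<longrightarrow>
                 (\<exists>C>0. \<forall>\<alpha>\<ge>1. \<forall>F \<in> borel_measurable (lebesgue_on upper_half).
                    weighted_Lp p w (area_fun 1 F)
                      \<le> ennreal (C * \<alpha> powr (- (real CARD('n) / (s * p)) - \<rho>))
                          * weighted_Lp p w (area_fun \<alpha> F)))))"
proof (intro conjI allI impI notI; elim exE conjE)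
  fix r p \<rho> :: real
  assume r: "1 \<le> r" and p: "0 < p" and \<rho>: "0 < \<rho>"
    and H: "\<forall>w :: real^'n \<Rightarrow> real. w \<in> muckenhoupt r \<longrightarrow>
                 (\<exists>C>0. \<forall>\<alpha>\<ge>1. \<forall>F \<in> borel_measurable (lebesgue_on upper_half).
                    weighted_Lp p w (area_fun \<alpha> F)
                      \<le> ennreal (C * \<alpha> powr (real CARD('n) * r / p - \<rho>))
                          * weighted_Lp p w (area_fun 1 F))"
  \<comment> \<open>The loss \<rho>p/2 keeps a strictly below the critical n(r - 1), and it costs at
    most \<rho>/2 in (n + a)/p, half of the supposed gain. The maximum with 0 covers r = 1 and large
    \<rho>.\<close>
  define a where "a = max 0 (real CARD('n) * (r - 1) - \<rho> * p / 2)"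
  have "a < real CARD('n) * (r - 1) \<or> a = 0"
    using \<rho> p by (auto simp: a_def max_def)
  then have "(power_weight a :: real^'n \<Rightarrow> real) \<in> muckenhoupt r"
    using r by (intro power_weight_in_muckenhoupt) (auto simp: a_def)
  moreover have "real CARD('n) * r / p - \<rho> < (real CARD('n) + a) / p"
  proof -
    have "0 < \<rho> * p" using \<rho> p by simp
    then have "real CARD('n) * r - \<rho> * p < real CARD('n) + a"
      by (auto simp: a_def max_def algebra_simps)
    then have "(real CARD('n) * r - \<rho> * p) / p < (real CARD('n) + a) / p"
      using p by (rule divide_strict_right_mono)
    then show ?thesis using p by (simp add: diff_divide_distrib)
  qed
  moreover have "0 \<le> a" by (simp add: a_def)
  ultimately show False
    using H area_fun_upper_exponent_sharp[OF p, of a] by blast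
next
  fix s p \<rho> :: real
  assume s: "1 \<le> s" and sp: "2 / s \<le> p" and \<rho>: "0 < \<rho>"
    and H: "\<forall>w :: real^'n \<Rightarrow> real. w \<in> reverse_hoelder (conj_exp s) \<longrightarrow>
                 (\<exists>C>0. \<forall>\<alpha>\<ge>1. \<forall>F \<in> borel_measurable (lebesgue_on upper_half).
                    weighted_Lp p w (area_fun 1 F)
                      \<le> ennreal (C * \<alpha> powr (- (real CARD('n) / (s * p)) - \<rho>))
                          * weighted_Lp p w (area_fun \<alpha> F))"
  have p: "0 < p" using s sp by (auto intro: less_le_trans[of 0 "2 / s"])
  \<comment> \<open>The mirror choice: a stays strictly above -n/s', or is 0, and (n + a)/p is at
    most n/(sp) + \<rho>/2.\<close>
  define a where "a = min 0 (- real CARD('n) * (s - 1) / s + \<rho> * p / 2)"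
  have pos: "0 < \<rho> * p" using \<rho> p by simp
  then have a: "- real CARD('n) * (s - 1) / s < a \<or> a = 0" "a \<le> 0"
    by (auto simp: a_def min_def)
  then have "(power_weight a :: real^'n \<Rightarrow> real) \<in> reverse_hoelder (conj_exp s)"
    using s by (intro power_weight_in_reverse_hoelder) auto
  moreover have "- real CARD('n) < - real CARD('n) * (s - 1) / s"
    using s by (simp add: field_simps)
  then have "- real CARD('n) < a" using a by fastforce
  moreover have "- (real CARD('n) / (s * p)) - \<rho> < - ((real CARD('n) + a) / p)"
  proof -
    have "a < - real CARD('n) * (s - 1) / s + \<rho> * p"
      using pos by (auto simp: a_def)
    also have "- real CARD('n) * (s - 1) / s = real CARD('n) / s - real CARD('n)"
      using s by (simp add: field_simps)
    finally have "(real CARD('n) + a) / p < (real CARD('n) / s + \<rho> * p) / p"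
      using p by (intro divide_strict_right_mono) auto
    then show ?thesis using p by (simp add: add_divide_distrib)
  qed
  ultimately show False
    using H a area_fun_lower_exponent_sharp[OF p, of a] by blast
qed

end
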